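(* Let $n=2$ or $n=3$. Let $H$ be an irreducible (entrywise) nonnegative real $n\times n$ matrix, let $A=\rho(H)I_n-H$, and let $v$ and $w$ be nonzero (entrywise) nonnegative vectors in $\mathbb{R}^n$; in the case $n=3$, assume in addition that $w^\top v\neq 0$. Then there is a $t_1>0$ such that for all $t>t_1$ all eigenvalues of $B(t)=A+tvw^\top$ are in the open right half plane $\{\lambda\in\mathbb{C}:\operatorname{Re}\lambda>0\}$.
   Context: $\rho(H)$ denotes the spectral radius of $H$. *)

theory Defs
  imports
    "Jordan_Normal_Form.Spectral_Radius"
    "HOL-Combinatorics.Permutations"
begin

(* Spectral radius and eigenvalues of a real matrix refer to its complex
   spectrum, hence the entrywise embedding. *)
abbreviation complex_mat :: "real mat \<Rightarrow> complex mat" where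
  "complex_mat \<equiv> map_mat complex_of_real"

(* A is reducible if some simultaneous row and column permutation P A P^T has the form
   [[B, C], [0, D]] with square diagonal blocks of sizes k and n - k, both nonzero.
   The (i, j) entry of P A P^T is A $$ (p i, p j). *)
definition reducible_mat :: "'a :: zero mat \<Rightarrow> bool" where
  "reducible_mat A \<longleftrightarrow>
     (\<exists>p k. p permutes {..<dim_row A} \<and> 0 < k \<and> k < dim_row A \<and>
        (\<forall>i\<in>{k..<dim_row A}. \<forall>j<k. A $$ (p i, p j) = 0))"

definition irreducible_mat :: "'a :: zero mat \<Rightarrow> bool" where
  "irreducible_mat A \<longleftrightarrow> square_mat A \<and> \<not> reducible_mat A"

definition outer_prod :: "'a :: times vec \<Rightarrow> 'a vec \<Rightarrow> 'a mat" where
  "outer_prod v w = mat (dim_vec v) (dim_vec w) (\<lambda>(i, j). v $ i * w $ j)"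

end

theory Submission
  imports Defs
begin

text \<open>
  Since \<open>char_poly H\<close> is positive beyond \<open>\<rho> = \<rho>(H)\<close> and nonpositive at the largest eigenvalue of
  each principal submatrix of size \<open>n - 1\<close>, \<open>A = \<rho> I - H\<close> has nonnegative determinant and nonnegative proper
  principal minors; irreducibility makes these minors, and hence all entries of \<open>adj A\<close>, positive.
  No Perron vector is needed.

  The coefficients \<open>c\<^sub>1, c\<^sub>2, c\<^sub>3\<close> (up to sign) of the characteristic polynomial of \<open>A + t v w\<^sup>T\<close> are
  affine in \<open>t\<close>, and the determinant \<open>det A + t w\<^sup>T adj(A) v\<close> is positive for \<open>t > 0\<close>. This suffices
  for \<open>n = 2\<close>. For \<open>n = 3\<close> the Routh-Hurwitz criterion requires in addition \<open>c\<^sub>1 c\<^sub>2 > c\<^sub>3\<close>, where the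
  left-hand side is quadratic in \<open>t\<close> with leading coefficient
  \<open>(w\<^sup>T v) (w\<^sup>T (tr(A) I - A) v)\<close>, which is positive as soon as \<open>w\<^sup>T v \<noteq> 0\<close>.
\<close>

section \<open>Real roots of the characteristic polynomial versus the spectral radius\<close>

lemma poly_root_above:
  fixes p :: "real poly"
  assumes lc: "lead_coeff p > 0" and neg: "poly p r < 0"
  shows "\<exists>s>r. poly p s = 0"
proof -
  obtain b where b: "\<And>x. x \<ge> b \<Longrightarrow> poly p x \<ge> lead_coeff p"
    using poly_pinfty_gt_lc[OF lc] by auto
  have "poly p (max b (r + 1)) > 0"
    using b[of "max b (r + 1)"] lc by auto
  moreover have "r < max b (r + 1)" by auto
  ultimately show ?thesis
    using poly_IVT_pos[of r "max b (r + 1)" p] neg by blast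
qed

lemma char_poly_root_le_spectral_radius:
  fixes H :: "real mat"
  assumes H: "H \<in> carrier_mat n n" and n: "n > 0" and root: "poly (char_poly H) s = 0"
  shows "s \<le> spectral_radius (complex_mat H)"
proof -
  have HC: "complex_mat H \<in> carrier_mat n n" using H by auto
  have "poly (char_poly (complex_mat H)) (of_real s) = 0"
    using root by (simp add: of_real_hom.char_poly_hom[OF H])
  then have "complex_of_real s \<in> spectrum (complex_mat H)"
    unfolding spectrum_root_char_poly[OF HC] by auto
  then have "norm (complex_of_real s) \<le> spectral_radius (complex_mat H)"
    using spectral_radius_mem_max(2)[OF HC n] by blast
  then show ?thesis by auto
qed

text \<open>The polynomial is monic, so a nonpositive value at \<open>r\<close> forces a real root
  at or beyond \<open>r\<close>. This later bounds eigenvalues of principal submatrices by the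
  spectral radius.\<close>

lemma char_poly_le_0_imp_le_spectral_radius:
  fixes H :: "real mat"
  assumes H: "H \<in> carrier_mat n n" and n: "n > 0" and neg: "poly (char_poly H) r \<le> 0"
  shows "r \<le> spectral_radius (complex_mat H)"
proof -
  have "lead_coeff (char_poly H) > 0"
    using degree_monic_char_poly[OF H] by auto
  then have "\<exists>s\<ge>r. poly (char_poly H) s = 0"
    using poly_root_above[of "char_poly H" r] neg
    by (cases "poly (char_poly H) r = 0") (auto intro: less_imp_le)
  then show ?thesis
    using char_poly_root_le_spectral_radius[OF H n] by force
qed

text \<open>A negative value would produce a real eigenvalue beyond the spectral radius. The value
  in question is \<open>det A\<close>.\<close>

lemma char_poly_spectral_radius_ge_0:
  fixes H :: "real mat"
  assumes H: "H \<in> carrier_mat n n" and n: "n > 0"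
  shows "poly (char_poly H) (spectral_radius (complex_mat H)) \<ge> 0"
proof (rule ccontr)
  assume "\<not> ?thesis"
  moreover have "lead_coeff (char_poly H) > 0"
    using degree_monic_char_poly[OF H] by auto
  ultimately obtain s where "s > spectral_radius (complex_mat H)" "poly (char_poly H) s = 0"
    using poly_root_above[of "char_poly H" "spectral_radius (complex_mat H)"] by auto
  then show False
    using char_poly_root_le_spectral_radius[OF H n, of s] by simp
qed

section \<open>Off-diagonal zero patterns excluded by irreducibility\<close>

lemma irreducible_row_nonzero:
  assumes H: "H \<in> carrier_mat n n" and irr: "irreducible_mat H" and n: "n \<ge> 2" and i: "i < n"
  shows "\<exists>j<n. j \<noteq> i \<and> H $$ (i, j) \<noteq> 0"
proof (rule ccontr)
  assume "\<not> ?thesis"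
  then have z: "j < n \<Longrightarrow> j \<noteq> i \<Longrightarrow> H $$ (i, j) = 0" for j by auto
  \<comment> \<open>With row \<open>i\<close> moved to the last place, its off-diagonal entries form
    the zero block for \<open>k = n - 1\<close>.\<close>
  let ?p = "transpose i (n - 1)"
  have p: "?p permutes {..<n}"
    using i by (intro permutes_swap_id) auto
  have "H $$ (?p k, ?p j) = 0" if k: "k \<in> {n - 1..<n}" and j: "j < n - 1" for k j
  proof -
    have "k = n - 1" using k by auto
    moreover have "?p j < n" using permutes_in_image[OF p, of j] j by auto
    moreover have "?p j \<noteq> i"
      using j by (metis less_irrefl transpose_apply_second transpose_eq_iff)
    ultimately show ?thesis using z by auto
  qed
  then have "reducible_mat H"
    unfolding reducible_mat_def using H p n
    by (intro exI[of _ ?p] exI[of _ "n - 1"]) auto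
  then show False using irr by (simp add: irreducible_mat_def)
qed

lemma irreducible_col_nonzero:
  assumes H: "H \<in> carrier_mat n n" and irr: "irreducible_mat H" and n: "n \<ge> 2" and j: "j < n"
  shows "\<exists>i<n. i \<noteq> j \<and> H $$ (i, j) \<noteq> 0"
proof (rule ccontr)
  assume "\<not> ?thesis"
  then have z: "i < n \<Longrightarrow> i \<noteq> j \<Longrightarrow> H $$ (i, j) = 0" for i by auto
  \<comment> \<open>Dually, with column \<open>j\<close> moved to the first place, its off-diagonal
    entries form the zero block for \<open>k = 1\<close>.\<close>
  let ?p = "transpose j 0"
  have p: "?p permutes {..<n}"
    using j by (intro permutes_swap_id) auto
  have "H $$ (?p i, ?p l) = 0" if i: "i \<in> {1..<n}" and l: "l < 1" for i l
  proof -
    have "?p i < n" using permutes_in_image[OF p, of i] i by auto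
    moreover have "?p i \<noteq> j"
      using i by (metis atLeastLessThan_iff not_one_le_zero transpose_apply_second transpose_eq_iff)
    ultimately show ?thesis using z l by auto
  qed
  then have "reducible_mat H"
    unfolding reducible_mat_def using H p n
    by (intro exI[of _ ?p] exI[of _ 1]) auto
  then show False using irr by (simp add: irreducible_mat_def)
qed

section \<open>Explicit determinants and characteristic polynomials in sizes 2 and 3\<close>

lemma det_2:
  fixes M :: "'a :: comm_ring_1 mat"
  assumes "M \<in> carrier_mat 2 2"
  shows "det M = M $$ (0,0) * M $$ (1,1) - M $$ (0,1) * M $$ (1,0)"
proof -
  have d: "det (mat_delete M 0 j) = mat_delete M 0 j $$ (0,0)" for j
    using mat_delete_carrier[OF assms, of 0 j] by (intro det_single) auto
  show ?thesis
    using assms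
    by (simp add: laplace_expansion_row[OF assms, of 0] numeral_2_eq_2 cofactor_def d)
       (simp add: mat_delete_def)
qed

lemma det_3:
  fixes M :: "'a :: comm_ring_1 mat"
  assumes "M \<in> carrier_mat 3 3"
  shows "det M =
    M $$ (0,0) * (M $$ (1,1) * M $$ (2,2) - M $$ (1,2) * M $$ (2,1)) -
    M $$ (0,1) * (M $$ (1,0) * M $$ (2,2) - M $$ (1,2) * M $$ (2,0)) +
    M $$ (0,2) * (M $$ (1,0) * M $$ (2,1) - M $$ (1,1) * M $$ (2,0))"
proof -
  have "mat_delete M 0 j \<in> carrier_mat 2 2" for j
    using mat_delete_carrier[OF assms, of 0 j] by simp
  note d = det_2[OF this]
  have lt3: "{..<3::nat} = {0, 1, 2}" by auto
  show ?thesis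
    using assms
    by (simp add: laplace_expansion_row[OF assms, of 0] lt3 cofactor_def d)
       (simp add: mat_delete_def numeral_2_eq_2 algebra_simps)
qed

text \<open>Index functions replace matrices here and below, so that one formula serves real and
  complex entries and, in \<open>char3\<close>, any order of the indices.\<close>

definition char2 :: "(nat \<Rightarrow> nat \<Rightarrow> 'a :: comm_ring_1) \<Rightarrow> 'a \<Rightarrow> 'a" where
  "char2 m x = (x - m 0 0) * (x - m 1 1) - m 0 1 * m 1 0"

text \<open>\<open>det (x I - m)\<close> for the principal submatrix with indices \<open>i, j, k\<close>, expanded along \<open>i\<close> so that
  the complementary minor on \<open>j, k\<close> is visible.\<close>

definition char3 :: "(nat \<Rightarrow> nat \<Rightarrow> 'a :: comm_ring_1) \<Rightarrow> nat \<Rightarrow> nat \<Rightarrow> nat \<Rightarrow> 'a \<Rightarrow> 'a" where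
  "char3 m i j k x =
    (x - m i i) * ((x - m j j) * (x - m k k) - m j k * m k j) -
    (m i j * m j i * (x - m k k) + m i j * m j k * m k i +
     m i k * m k j * m j i + m i k * m k i * (x - m j j))"

text \<open>Rotating the indices carries facts about one principal minor to the other two.\<close>

lemma char3_cyclic: "char3 m i j k x = char3 m j k i x"
  by (simp add: char3_def algebra_simps)

lemma poly_char_poly_2:
  assumes M: "(M :: 'a :: field mat) \<in> carrier_mat 2 2"
  shows "poly (char_poly M) x = char2 (\<lambda>i j. M $$ (i, j)) x"
proof -
  have "- char_matrix M x \<in> carrier_mat 2 2" using M by auto
  then show ?thesis using M
    unfolding char_poly_matrix[OF M] by (simp add: det_2 char_matrix_def char2_def algebra_simps)
qed

lemma poly_char_poly_3:
  assumes M: "(M :: 'a :: field mat) \<in> carrier_mat 3 3"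
  shows "poly (char_poly M) x = char3 (\<lambda>i j. M $$ (i, j)) 0 1 2 x"
proof -
  have "- char_matrix M x \<in> carrier_mat 3 3" using M by auto
  then show ?thesis using M
    unfolding char_poly_matrix[OF M] by (simp add: det_3 char_matrix_def char3_def algebra_simps)
qed

section \<open>Root location criteria in degrees 2 and 3\<close>

lemma quadratic_root_Re_pos:
  fixes \<mu> :: complex and c1 c2 :: real
  assumes root: "\<mu>\<^sup>2 - of_real c1 * \<mu> + of_real c2 = 0" and "c1 > 0" "c2 > 0"
  shows "Re \<mu> > 0"
proof (rule ccontr)
  assume "\<not> ?thesis"
  then have x: "Re \<mu> \<le> 0" by simp
  let ?x = "Re \<mu>" and ?y = "Im \<mu>"
  have re: "?x\<^sup>2 - ?y\<^sup>2 - c1 * ?x + c2 = 0" and im: "?y * (2 * ?x - c1) = 0"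
    using root by (simp_all add: complex_eq_iff power2_eq_square algebra_simps)
  \<comment> \<open>For \<open>?x \<le> 0\<close> the factor \<open>2 * ?x - c1\<close> is negative,
    so the root is real.\<close>
  have "?y = 0" using im x assms(2) by auto
  moreover have "c1 * ?x \<le> 0" using x assms(2) by (simp add: mult_nonneg_nonpos)
  ultimately have "?x\<^sup>2 - ?y\<^sup>2 - c1 * ?x + c2 > 0" using assms(3)
    by (smt (verit) zero_le_power2 zero_power2)
  then show False using re by simp
qed

text \<open>Sufficiency in the Routh-Hurwitz criterion, reflected to the right half plane. For a
  nonreal root the imaginary part of the equation determines \<open>y\<^sup>2\<close>; substituting
  it into the real part leaves a cubic in \<open>x\<close> with positive coefficients and constant
  term \<open>c1 * c2 - c3\<close>, which has no root \<open>x \<ge> 0\<close>.\<close>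

lemma cubic_root_Re_pos:
  fixes \<mu> :: complex and c1 c2 c3 :: real
  assumes root: "\<mu> ^ 3 - of_real c1 * \<mu>\<^sup>2 + of_real c2 * \<mu> - of_real c3 = 0"
    and c: "c1 > 0" "c3 > 0" "c1 * c2 > c3"
  shows "Re \<mu> > 0"
proof (rule ccontr)
  assume nonpos: "\<not> Re \<mu> > 0"
  define x y where "x = - Re \<mu>" and "y = Im \<mu>"
  have x: "x \<ge> 0" using nonpos by (simp add: x_def)
  have c2: "c2 > 0"
    using c by (smt (verit) mult_nonneg_nonpos)
  have mu: "\<mu> = Complex (- x) y" by (simp add: x_def y_def)
  have re: "x ^ 3 - 3 * x * y\<^sup>2 + c1 * (x\<^sup>2 - y\<^sup>2) + c2 * x + c3 = 0"
    and im: "y * (3 * x\<^sup>2 - y\<^sup>2 + 2 * c1 * x + c2) = 0"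
    using root
    by (simp_all add: mu complex_eq_iff power2_eq_square power3_eq_cube algebra_simps)
  show False
  proof (cases "y = 0")
    case True
    have "x ^ 3 + c1 * x\<^sup>2 + c2 * x \<ge> 0" using x c c2 by simp
    then show False using re True c by simp
  next
    case False
    then have y2: "y\<^sup>2 = 3 * x\<^sup>2 + 2 * c1 * x + c2" using im by simp
    have "8 * x ^ 3 + 8 * c1 * x\<^sup>2 + 2 * (c2 + c1\<^sup>2) * x + (c1 * c2 - c3) = 0"
      using re unfolding y2 by (simp add: power2_eq_square power3_eq_cube algebra_simps)
    moreover have "8 * x ^ 3 + 8 * c1 * x\<^sup>2 + 2 * (c2 + c1\<^sup>2) * x \<ge> 0"
      using x c c2 by simp
    ultimately show False using c by simp
  qed
qed

section \<open>Principal minors of \<rho> I - h\<close>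

lemma largest_root_2x2:
  fixes a b c d :: real
  assumes "b \<ge> 0" "c \<ge> 0"
  shows "\<exists>r. a \<le> r \<and> d \<le> r \<and> (r - a) * (r - d) = b * c"
proof -
  \<comment> \<open>The square root of the discriminant of the matrix with rows
    \<open>(a, b)\<close> and \<open>(c, d)\<close>. It is at least
    \<open>\<bar>a - d\<bar>\<close>, which places the larger eigenvalue above both diagonal
    entries.\<close>
  define s where "s = sqrt ((a - d)\<^sup>2 + 4 * (b * c))"
  have bc: "b * c \<ge> 0" using assms by simp
  have "\<bar>a - d\<bar> \<le> s" unfolding s_def using bc by (intro real_le_rsqrt) simp
  moreover have "s\<^sup>2 = (a - d)\<^sup>2 + 4 * (b * c)" unfolding s_def using bc by simp
  then have "((a + d + s) / 2 - a) * ((a + d + s) / 2 - d) = b * c"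
    by (simp add: power2_eq_square field_simps)
  ultimately show ?thesis by (intro exI[of _ "(a + d + s) / 2"]) auto
qed

text \<open>The largest eigenvalue of the block on \<open>q, s\<close> is at most
  \<open>\<rho>\<close>, and from there up to \<open>\<rho>\<close> both factors of the diagonal
  product are nonnegative and grow.\<close>

lemma principal_minor_nonneg:
  fixes h :: "nat \<Rightarrow> nat \<Rightarrow> real"
  assumes h: "\<And>i j. i \<in> {p, q, s} \<Longrightarrow> j \<in> {p, q, s} \<Longrightarrow> h i j \<ge> 0"
    and le: "\<And>r. char3 h p q s r \<le> 0 \<Longrightarrow> r \<le> \<rho>"
  shows "\<rho> \<ge> h q q" "\<rho> \<ge> h s s" "(\<rho> - h q q) * (\<rho> - h s s) \<ge> h q s * h s q"
proof -
  \<comment> \<open>\<open>r\<close> is the Perron root of the block on \<open>q, s\<close>, where the first term of \<open>char3\<close> vanishes.\<close>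
  obtain r where r: "h q q \<le> r" "h s s \<le> r" "(r - h q q) * (r - h s s) = h q s * h s q"
    using largest_root_2x2[of "h q s" "h s q" "h q q" "h s s"] h by auto
  have "h p q * h q p * (r - h s s) \<ge> 0" "h p q * h q s * h s p \<ge> 0"
    "h p s * h s q * h q p \<ge> 0" "h p s * h s p * (r - h q q) \<ge> 0"
    using h r by auto
  then have "char3 h p q s r \<le> 0"
    unfolding char3_def r(3) by simp
  then have "r \<le> \<rho>" by (rule le)
  then show "\<rho> \<ge> h q q" "\<rho> \<ge> h s s" using r by auto
  show "(\<rho> - h q q) * (\<rho> - h s s) \<ge> h q s * h s q"
    unfolding r(3)[symmetric] using r \<open>r \<le> \<rho>\<close> by (intro mult_mono) auto
qed

text \<open>If the minor on \<open>q, s\<close> were zero, \<open>char3\<close> at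
  \<open>\<rho>\<close> would be minus a sum of four nonnegative products, so each product would
  vanish. Every such zero pattern contradicts the row and column hypotheses or the minor on
  \<open>s, p\<close>.\<close>

lemma principal_minor_pos:
  fixes h :: "nat \<Rightarrow> nat \<Rightarrow> real"
  assumes h: "\<And>i j. i \<in> {p, q, s} \<Longrightarrow> j \<in> {p, q, s} \<Longrightarrow> h i j \<ge> 0"
    and le: "\<And>r. char3 h p q s r \<le> 0 \<Longrightarrow> r \<le> \<rho>"
    and det: "char3 h p q s \<rho> \<ge> 0"
    and row: "h p q \<noteq> 0 \<or> h p s \<noteq> 0" "h q p \<noteq> 0 \<or> h q s \<noteq> 0" "h s p \<noteq> 0 \<or> h s q \<noteq> 0"
    and col: "h q p \<noteq> 0 \<or> h s p \<noteq> 0" "h p q \<noteq> 0 \<or> h s q \<noteq> 0" "h p s \<noteq> 0 \<or> h q s \<noteq> 0"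
  shows "(\<rho> - h q q) * (\<rho> - h s s) > h q s * h s q" "\<rho> > h q q" "\<rho> > h s s"
proof -
  have h0: "h p q \<ge> 0" "h q p \<ge> 0" "h p s \<ge> 0" "h s p \<ge> 0" "h q s \<ge> 0" "h s q \<ge> 0"
    using h by auto
  have m1: "\<rho> \<ge> h q q" "\<rho> \<ge> h s s" "(\<rho> - h q q) * (\<rho> - h s s) \<ge> h q s * h s q"
    using principal_minor_nonneg[of p q s h \<rho>] h le by auto
  have m2: "(\<rho> - h s s) * (\<rho> - h p p) \<ge> h s p * h p s"
    using principal_minor_nonneg(3)[of q s p h \<rho>] h le char3_cyclic[of h p q s] by auto
  show m: "(\<rho> - h q q) * (\<rho> - h s s) > h q s * h s q"
  proof (rule ccontr)
    assume "\<not> ?thesis"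
    then have eq: "(\<rho> - h q q) * (\<rho> - h s s) = h q s * h s q" using m1 by simp
    have "h p q * h q p * (\<rho> - h s s) + h p q * h q s * h s p +
        h p s * h s q * h q p + h p s * h s p * (\<rho> - h q q) \<le> 0"
      using det unfolding char3_def eq by simp
    moreover have "h p q * h q p * (\<rho> - h s s) \<ge> 0" "h p q * h q s * h s p \<ge> 0"
      "h p s * h s q * h q p \<ge> 0" "h p s * h s p * (\<rho> - h q q) \<ge> 0"
      using h0 m1 by auto
    ultimately have z: "h p q * h q p * (\<rho> - h s s) = 0" "h p q * h q s * h s p = 0"
      "h p s * h s q * h q p = 0" "h p s * h s p * (\<rho> - h q q) = 0"
      by linarith+
    show False
    proof (cases "h q s = 0 \<or> h s q = 0")
      case False
      \<comment> \<open>After cancelling nonzero factors, every product of an off-diagonal entry of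
        row \<open>p\<close> with one of column \<open>p\<close> is zero, so that row or that column
        vanishes off the diagonal.\<close>
      then have "\<rho> - h q q \<noteq> 0" "\<rho> - h s s \<noteq> 0" using eq by auto
      then show False using z row(1) col(1) False by auto
    next
      case True
      \<comment> \<open>If only one of the two were zero, the row and column conditions would make
        one of the 3-cycle products in \<open>z\<close> nonzero.\<close>
      then have "h q s = 0 \<and> h s q = 0"
        using z row col by auto
      then have "h q p \<noteq> 0" "h p s \<noteq> 0" "h s p \<noteq> 0" "h p q \<noteq> 0" "\<rho> - h s s = 0"
        using row col z by auto
      \<comment> \<open>The minor on \<open>s, p\<close> has the factor
        \<open>\<rho> - h s s = 0\<close>, so it would be negative.\<close>
      moreover from this have "h s p * h p s > 0" using h0 by (simp add: less_le)
      ultimately show False using m2 by simp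
    qed
  qed
  have "h q s * h s q \<ge> 0" using h0 by simp
  then have "(\<rho> - h q q) * (\<rho> - h s s) > 0" using m by linarith
  then show "\<rho> > h q q" "\<rho> > h s s"
    using m1 by (auto simp: zero_less_mult_iff)
qed

section \<open>Positivity of bilinear forms, and of quadratics for large arguments\<close>

lemma bilinear_form_pos:
  fixes M :: "nat \<Rightarrow> nat \<Rightarrow> real"
  assumes "\<And>i j. i < n \<Longrightarrow> j < n \<Longrightarrow> M i j \<ge> 0"
    and "\<And>i. i < n \<Longrightarrow> w i \<ge> 0" "\<And>i. i < n \<Longrightarrow> v i \<ge> 0"
    and "i0 < n" "j0 < n" "M i0 j0 > 0" "w i0 \<noteq> 0" "v j0 \<noteq> 0"
  shows "(\<Sum>i<n. \<Sum>j<n. w i * M i j * v j) > 0"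
proof -
  have "w i0 * M i0 j0 * v j0 > 0"
    using assms by (metis mult_pos_pos order_le_imp_less_or_eq)
  then have pos: "(\<Sum>j<n. w i0 * M i0 j * v j) > 0"
    using assms by (intro sum_pos2[of _ j0]) auto
  have nonneg: "(\<Sum>j<n. w i * M i j * v j) \<ge> 0" if "i \<in> {..<n}" for i
    using assms that by (intro sum_nonneg) auto
  show ?thesis
    by (rule sum_pos2[where i = i0]) (use assms(4) pos nonneg in auto)
qed

lemma eventually_quadratic_pos:
  fixes a b c :: real
  assumes "a > 0"
  shows "\<exists>t1>0. \<forall>t>t1. a * t\<^sup>2 + b * t + c > 0"
\<comment> \<open>Beyond this bound \<open>t > 1\<close> and
  \<open>a * t > \<bar>b\<bar> + \<bar>c\<bar>\<close>; multiplying by \<open>t\<close> makes the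
  quadratic term dominate.\<close>
proof (intro exI[of _ "1 + (\<bar>b\<bar> + \<bar>c\<bar>) / a"] conjI allI impI)
  show "1 + (\<bar>b\<bar> + \<bar>c\<bar>) / a > 0" using assms by (simp add: add_pos_nonneg)
  fix t assume t: "t > 1 + (\<bar>b\<bar> + \<bar>c\<bar>) / a"
  have t1: "t > 1" using t assms by (smt (verit) divide_nonneg_pos)
  have "(\<bar>b\<bar> + \<bar>c\<bar>) / a < t" using t by simp
  then have "\<bar>b\<bar> + \<bar>c\<bar> < a * t" using assms by (simp add: pos_divide_less_eq mult.commute)
  then have "(\<bar>b\<bar> + \<bar>c\<bar>) * t < a * t * t" using t1 by (intro mult_strict_right_mono) auto
  moreover have "\<bar>c\<bar> * 1 \<le> \<bar>c\<bar> * t" using t1 by (intro mult_left_mono) auto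
  moreover have "- (\<bar>b\<bar> * t) \<le> b * t" using t1 by (smt (verit) mult_minus_left mult_right_mono)
  ultimately show "a * t\<^sup>2 + b * t + c > 0"
    by (simp add: power2_eq_square algebra_simps)
qed

section \<open>Coefficients of the perturbed characteristic polynomial\<close>

definition trace3 :: "(nat \<Rightarrow> nat \<Rightarrow> 'a :: comm_ring_1) \<Rightarrow> 'a" where
  "trace3 m = m 0 0 + m 1 1 + m 2 2"

definition minor_sum3 :: "(nat \<Rightarrow> nat \<Rightarrow> 'a :: comm_ring_1) \<Rightarrow> 'a" where
  "minor_sum3 m = m 0 0 * m 1 1 - m 0 1 * m 1 0 + m 0 0 * m 2 2 - m 0 2 * m 2 0 +
    m 1 1 * m 2 2 - m 1 2 * m 2 1"

definition det3 :: "(nat \<Rightarrow> nat \<Rightarrow> 'a :: comm_ring_1) \<Rightarrow> 'a" where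
  "det3 m = m 0 0 * (m 1 1 * m 2 2 - m 1 2 * m 2 1) - m 0 1 * (m 1 0 * m 2 2 - m 1 2 * m 2 0) +
    m 0 2 * (m 1 0 * m 2 1 - m 1 1 * m 2 0)"

lemma char3_expand:
  "char3 m 0 1 2 x = x ^ 3 - trace3 m * x\<^sup>2 + minor_sum3 m * x - det3 m"
  by (simp add: char3_def trace3_def minor_sum3_def det3_def power2_eq_square power3_eq_cube
      algebra_simps)

definition shifted :: "'a :: comm_ring_1 \<Rightarrow> (nat \<Rightarrow> nat \<Rightarrow> 'a) \<Rightarrow> nat \<Rightarrow> nat \<Rightarrow> 'a" where
  "shifted r h i j = (if i = j then r else 0) - h i j"

text \<open>The adjugate of \<open>r I - h\<close>; for distinct indices \<open>i, j < 3\<close> the third one is \<open>3 - i - j\<close>.\<close>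

definition adj3 :: "'a :: comm_ring_1 \<Rightarrow> (nat \<Rightarrow> nat \<Rightarrow> 'a) \<Rightarrow> nat \<Rightarrow> nat \<Rightarrow> 'a" where
  "adj3 r h i j =
    (if i = j then
       let k = (i + 1) mod 3; l = (i + 2) mod 3 in (r - h k k) * (r - h l l) - h k l * h l k
     else let k = 3 - i - j in h i j * (r - h k k) + h i k * h k j)"

text \<open>For \<open>A = shifted r h\<close> this is tr(A) I - A, the matrix of the bilinear form
  by which a rank-one update changes \<open>minor_sum3\<close>.\<close>

definition trace_diff3 :: "'a :: comm_ring_1 \<Rightarrow> (nat \<Rightarrow> nat \<Rightarrow> 'a) \<Rightarrow> nat \<Rightarrow> nat \<Rightarrow> 'a" where
  "trace_diff3 r h i j = (if i = j then trace3 (shifted r h) else 0) - shifted r h i j"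

lemma lessThan_3: "{..<3::nat} = {0, 1, 2}"
  by auto

lemma rank_one_trace3:
  "trace3 (\<lambda>i j. shifted r h i j + t * (v i * w j)) =
    trace3 (shifted r h) + t * (\<Sum>i<3. w i * v i)"
  by (simp add: trace3_def lessThan_3 algebra_simps)

text \<open>The terms in \<open>t\<^sup>2\<close> cancel because the 2 by 2 minors of a rank-one
  matrix vanish.\<close>

lemma rank_one_minor_sum3:
  "minor_sum3 (\<lambda>i j. shifted r h i j + t * (v i * w j)) =
    minor_sum3 (shifted r h) + t * (\<Sum>i<3. \<Sum>j<3. w i * trace_diff3 r h i j * v j)"
  by (simp add: minor_sum3_def trace_diff3_def trace3_def lessThan_3 algebra_simps)

text \<open>The matrix determinant lemma in size 3; the constant term is det(r I - h).\<close>

lemma rank_one_det3: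
  "det3 (\<lambda>i j. shifted r h i j + t * (v i * w j)) =
    char3 h 0 1 2 r + t * (\<Sum>i<3. \<Sum>j<3. w i * adj3 r h i j * v j)"
  by (simp add: det3_def char3_def shifted_def adj3_def Let_def lessThan_3 numeral_2_eq_2 algebra_simps)

lemma char3_of_real:
  "char3 (\<lambda>i j. complex_of_real (m i j)) 0 1 2 x =
    x ^ 3 - of_real (trace3 m) * x\<^sup>2 + of_real (minor_sum3 m) * x - of_real (det3 m)"
  unfolding char3_expand by (simp add: trace3_def minor_sum3_def det3_def)

text \<open>The factor of \<open>t\<close> in the last coefficient is the bilinear form of the
  adjugate of r I - h, written out.\<close>

lemma char2_rank_one_of_real:
  "char2 (\<lambda>i j. complex_of_real (shifted r h i j + t * (v i * w j))) x =
    x\<^sup>2 - of_real (shifted r h 0 0 + shifted r h 1 1 + t * (w 0 * v 0 + w 1 * v 1)) * x +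
    of_real (char2 h r + t * (w 0 * v 0 * (r - h 1 1) + w 0 * v 1 * h 0 1 +
      w 1 * v 0 * h 1 0 + w 1 * v 1 * (r - h 0 0)))"
  by (simp add: char2_def shifted_def power2_eq_square algebra_simps)

section \<open>Stability of the perturbed matrix in dimensions 2 and 3\<close>

lemma rank_one_stable_2:
  fixes h :: "nat \<Rightarrow> nat \<Rightarrow> real"
  assumes h: "\<And>i j. i < 2 \<Longrightarrow> j < 2 \<Longrightarrow> h i j \<ge> 0" and off: "h 0 1 \<noteq> 0" "h 1 0 \<noteq> 0"
    and le: "\<And>r. char2 h r \<le> 0 \<Longrightarrow> r \<le> \<rho>" and det: "char2 h \<rho> \<ge> 0"
    and v: "\<And>i. i < 2 \<Longrightarrow> v i \<ge> 0" "i0 < 2" "v i0 \<noteq> 0"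
    and w: "\<And>i. i < 2 \<Longrightarrow> w i \<ge> 0" "j0 < 2" "w j0 \<noteq> 0"
    and t: "t > 0"
    and root: "char2 (\<lambda>i j. complex_of_real (shifted \<rho> h i j + t * (v i * w j))) \<mu> = 0"
  shows "Re \<mu> > 0"
proof -
  have pos: "h 0 1 > 0" "h 1 0 > 0" using h[of 0 1] h[of 1 0] off by (auto simp: less_le)
  \<comment> \<open>At either diagonal entry \<open>char2 h\<close> equals
    \<open>- (h 0 1 * h 1 0)\<close>.\<close>
  have "\<rho> \<ge> h 0 0" "\<rho> \<ge> h 1 1"
    using le[of "h 0 0"] le[of "h 1 1"] pos by (auto simp: char2_def)
  moreover have "(\<rho> - h 0 0) * (\<rho> - h 1 1) > 0"
    using det mult_pos_pos[OF pos] by (simp add: char2_def)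
  ultimately have d: "\<rho> > h 0 0" "\<rho> > h 1 1"
    by (auto simp: zero_less_mult_iff)
  have nn: "v 0 \<ge> 0" "v 1 \<ge> 0" "w 0 \<ge> 0" "w 1 \<ge> 0" using v(1) w(1) by auto
  have "w 0 * v 0 + w 1 * v 1 \<ge> 0" using nn by simp
  then have c1: "shifted \<rho> h 0 0 + shifted \<rho> h 1 1 + t * (w 0 * v 0 + w 1 * v 1) > 0"
    using d t by (intro add_pos_nonneg) (auto simp: shifted_def)
  have "v 0 > 0 \<or> v 1 > 0" "w 0 > 0 \<or> w 1 > 0"
    using less_2_cases[OF v(2)] less_2_cases[OF w(2)] v(3) w(3) nn by (auto simp: less_le)
  moreover have "w 0 * v 0 * (\<rho> - h 1 1) \<ge> 0" "w 0 * v 1 * h 0 1 \<ge> 0"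
    "w 1 * v 0 * h 1 0 \<ge> 0" "w 1 * v 1 * (\<rho> - h 0 0) \<ge> 0"
    using nn pos d by auto
  moreover have "w 0 > 0 \<Longrightarrow> v 0 > 0 \<Longrightarrow> w 0 * v 0 * (\<rho> - h 1 1) > 0"
    "w 0 > 0 \<Longrightarrow> v 1 > 0 \<Longrightarrow> w 0 * v 1 * h 0 1 > 0"
    "w 1 > 0 \<Longrightarrow> v 0 > 0 \<Longrightarrow> w 1 * v 0 * h 1 0 > 0"
    "w 1 > 0 \<Longrightarrow> v 1 > 0 \<Longrightarrow> w 1 * v 1 * (\<rho> - h 0 0) > 0"
    using pos d by simp_all
  ultimately have "w 0 * v 0 * (\<rho> - h 1 1) + w 0 * v 1 * h 0 1 +
      w 1 * v 0 * h 1 0 + w 1 * v 1 * (\<rho> - h 0 0) > 0"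
    by linarith
  then have c2: "char2 h \<rho> + t * (w 0 * v 0 * (\<rho> - h 1 1) + w 0 * v 1 * h 0 1 +
      w 1 * v 0 * h 1 0 + w 1 * v 1 * (\<rho> - h 0 0)) > 0"
    using det t by (intro add_nonneg_pos) auto
  show ?thesis
    by (rule quadratic_root_Re_pos[OF root[unfolded char2_rank_one_of_real] c1 c2])
qed

lemma less_3_cases: "(i::nat) < 3 \<Longrightarrow> i = 0 \<or> i = 1 \<or> i = 2"
  by auto

text \<open>Diagonal entries are the principal minors. An off-diagonal entry could vanish only if
  \<open>h i j = 0\<close> and one of \<open>h i k\<close>, \<open>h k j\<close> is zero, so that
  row \<open>i\<close> or column \<open>j\<close> would vanish off the diagonal.\<close>

lemma adj3_pos:
  fixes h :: "nat \<Rightarrow> nat \<Rightarrow> real"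
  assumes h: "\<And>i j. i < 3 \<Longrightarrow> j < 3 \<Longrightarrow> h i j \<ge> 0"
    and minors: "(\<rho> - h 0 0) * (\<rho> - h 1 1) > h 0 1 * h 1 0"
      "(\<rho> - h 1 1) * (\<rho> - h 2 2) > h 1 2 * h 2 1"
      "(\<rho> - h 2 2) * (\<rho> - h 0 0) > h 2 0 * h 0 2"
    and diag: "\<And>i. i < 3 \<Longrightarrow> h i i < \<rho>"
    and row: "\<And>i. i < 3 \<Longrightarrow> \<exists>j<3. j \<noteq> i \<and> h i j \<noteq> 0"
    and col: "\<And>j. j < 3 \<Longrightarrow> \<exists>i<3. i \<noteq> j \<and> h i j \<noteq> 0"
    and ij: "i < 3" "j < 3"
  shows "adj3 \<rho> h i j > 0"
proof (cases "i = j")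
  case True
  then show ?thesis
    using less_3_cases[OF ij(1)] minors by (auto simp: adj3_def Let_def numeral_2_eq_2 mult.commute)
next
  case False
  define k where "k = 3 - i - j"
  have k: "k < 3" "{..<3} = {i, j, k}" "k \<noteq> i" "k \<noteq> j"
    using less_3_cases[OF ij(1)] less_3_cases[OF ij(2)] False by (auto simp: k_def)
  have "h i j \<noteq> 0 \<or> h i k \<noteq> 0" "h i j \<noteq> 0 \<or> h k j \<noteq> 0"
    using row[OF ij(1)] col[OF ij(2)] k(2) by (metis insertE lessThan_iff singletonD)+
  then have *: "h i j > 0 \<or> h i k > 0 \<and> h k j > 0"
    using h ij k(1) by (metis less_le)
  have "h i j * (\<rho> - h k k) \<ge> 0" "h i k * h k j \<ge> 0"
    "h i j > 0 \<Longrightarrow> h i j * (\<rho> - h k k) > 0"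
    "h i k > 0 \<Longrightarrow> h k j > 0 \<Longrightarrow> h i k * h k j > 0"
    using h ij k(1) diag[of k] by simp_all
  then have "h i j * (\<rho> - h k k) + h i k * h k j > 0"
    using * by linarith
  then show ?thesis using False by (simp add: adj3_def Let_def k_def)
qed

text \<open>The Routh-Hurwitz coefficients are \<open>tr + t * a\<close>, \<open>e + t * b\<close>
  and \<open>\<delta> + t * c\<close> with \<open>a\<close>, \<open>b\<close>, \<open>c\<close>
  positive, so the product condition holds for large \<open>t\<close>.\<close>

lemma rank_one_stable_3:
  fixes h :: "nat \<Rightarrow> nat \<Rightarrow> real"
  assumes h: "\<And>i j. i < 3 \<Longrightarrow> j < 3 \<Longrightarrow> h i j \<ge> 0"
    and row: "\<And>i. i < 3 \<Longrightarrow> \<exists>j<3. j \<noteq> i \<and> h i j \<noteq> 0"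
    and col: "\<And>j. j < 3 \<Longrightarrow> \<exists>i<3. i \<noteq> j \<and> h i j \<noteq> 0"
    and le: "\<And>r. char3 h 0 1 2 r \<le> 0 \<Longrightarrow> r \<le> \<rho>" and det: "char3 h 0 1 2 \<rho> \<ge> 0"
    and v: "\<And>i. i < 3 \<Longrightarrow> v i \<ge> 0" and w: "\<And>i. i < 3 \<Longrightarrow> w i \<ge> 0"
    and wv: "(\<Sum>i<3. w i * v i) \<noteq> 0"
  shows "\<exists>t1>0. \<forall>t>t1. \<forall>\<mu>.
    char3 (\<lambda>i j. complex_of_real (shifted \<rho> h i j + t * (v i * w j))) 0 1 2 \<mu> = 0 \<longrightarrow> Re \<mu> > 0"
proof -
  have rows: "h 0 1 \<noteq> 0 \<or> h 0 2 \<noteq> 0" "h 1 0 \<noteq> 0 \<or> h 1 2 \<noteq> 0" "h 2 0 \<noteq> 0 \<or> h 2 1 \<noteq> 0"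
    using row[of 0] row[of 1] row[of 2] by (auto dest!: less_3_cases)
  have cols: "h 1 0 \<noteq> 0 \<or> h 2 0 \<noteq> 0" "h 0 1 \<noteq> 0 \<or> h 2 1 \<noteq> 0" "h 0 2 \<noteq> 0 \<or> h 1 2 \<noteq> 0"
    using col[of 0] col[of 1] col[of 2] by (auto dest!: less_3_cases)
  have cyc: "char3 h 1 2 0 = char3 h 0 1 2" "char3 h 2 0 1 = char3 h 0 1 2"
    by (metis char3_cyclic ext)+
  have le': "char3 h 1 2 0 r \<le> 0 \<Longrightarrow> r \<le> \<rho>" "char3 h 2 0 1 r \<le> 0 \<Longrightarrow> r \<le> \<rho>" for r
    unfolding cyc by (fact le)+
  have det': "char3 h 1 2 0 \<rho> \<ge> 0" "char3 h 2 0 1 \<rho> \<ge> 0"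
    unfolding cyc by (fact det)+
  have m0: "(\<rho> - h 1 1) * (\<rho> - h 2 2) > h 1 2 * h 2 1" "\<rho> > h 1 1" "\<rho> > h 2 2"
    by (rule principal_minor_pos[OF _ le det]; (rule h; force | use rows cols in blast))+
  have m1: "(\<rho> - h 2 2) * (\<rho> - h 0 0) > h 2 0 * h 0 2" "\<rho> > h 2 2" "\<rho> > h 0 0"
    by (rule principal_minor_pos[OF _ le'(1) det'(1)]; (rule h; force | use rows cols in blast))+
  have m2: "(\<rho> - h 0 0) * (\<rho> - h 1 1) > h 0 1 * h 1 0"
    by (rule principal_minor_pos[OF _ le'(2) det'(2)]; (rule h; force | use rows cols in blast))
  have diag: "h i i < \<rho>" if "i < 3" for i
    using less_3_cases[OF that] m0 m1 by auto
  define a where "a = (\<Sum>i<3. w i * v i)"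
  define b where "b = (\<Sum>i<3. \<Sum>j<3. w i * trace_diff3 \<rho> h i j * v j)"
  define c where "c = (\<Sum>i<3. \<Sum>j<3. w i * adj3 \<rho> h i j * v j)"
  \<comment> \<open>A nonzero inner product yields an index in both supports, so a positive diagonal
    entry is enough to make each bilinear form positive.\<close>
  obtain i0 where i0: "i0 < 3" "w i0 \<noteq> 0" "v i0 \<noteq> 0"
    using wv by (metis (no_types, lifting) lessThan_iff mult_eq_0_iff sum.neutral)
  have a: "a > 0"
    using wv v w unfolding a_def by (auto intro!: sum_nonneg simp: less_le)
  have td: "trace_diff3 \<rho> h i j \<ge> 0" if "i < 3" "j < 3" for i j
    using less_3_cases[OF that(1)] less_3_cases[OF that(2)] h[OF that] diag[of 0] diag[of 1] diag[of 2]
    by (auto simp: trace_diff3_def trace3_def shifted_def)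
  \<comment> \<open>This diagonal entry is the sum of the other two diagonal entries of
    \<open>shifted \<rho> h\<close>.\<close>
  have td0: "trace_diff3 \<rho> h i0 i0 > 0"
    using less_3_cases[OF i0(1)] diag[of 0] diag[of 1] diag[of 2]
    by (auto simp: trace_diff3_def trace3_def shifted_def)
  have b: "b > 0"
    unfolding b_def using td v w i0 td0 by (intro bilinear_form_pos[of 3 _ w v i0 i0]) auto
  have adj: "adj3 \<rho> h i j > 0" if "i < 3" "j < 3" for i j
    by (rule adj3_pos[OF h m2 m0(1) m1(1) diag row col that])
  have c: "c > 0"
    unfolding c_def using adj v w i0
    by (intro bilinear_form_pos[of 3 _ w v i0 i0]) (auto intro: less_imp_le)
  define tr e \<delta> where "tr = trace3 (shifted \<rho> h)" and "e = minor_sum3 (shifted \<rho> h)"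
    and "\<delta> = char3 h 0 1 2 \<rho>"
  have tr: "tr > 0"
    using diag[of 0] diag[of 1] diag[of 2] by (simp add: tr_def trace3_def shifted_def)
  \<comment> \<open>The quadratic is \<open>(tr + t * a) * (e + t * b) - (\<delta> + t * c)\<close>,
    expanded in \<open>t\<close>.\<close>
  obtain t1 where t1: "t1 > 0"
    "\<And>t. t > t1 \<Longrightarrow> a * b * t\<^sup>2 + (tr * b + a * e - c) * t + (tr * e - \<delta>) > 0"
    using eventually_quadratic_pos[of "a * b"] a b by (metis mult_pos_pos)
  show ?thesis
  proof (intro exI[of _ t1] conjI allI impI)
    fix t \<mu> assume t: "t > t1"
      and root: "char3 (\<lambda>i j. complex_of_real (shifted \<rho> h i j + t * (v i * w j))) 0 1 2 \<mu> = 0"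
    have "t > 0" using t t1 by simp
    show "Re \<mu> > 0"
    proof (rule cubic_root_Re_pos)
      show "\<mu> ^ 3 - of_real (tr + t * a) * \<mu>\<^sup>2 + of_real (e + t * b) * \<mu> - of_real (\<delta> + t * c) = 0"
        using root
        unfolding char3_of_real rank_one_trace3 rank_one_minor_sum3 rank_one_det3
          tr_def e_def \<delta>_def a_def b_def c_def .
      show "tr + t * a > 0" "\<delta> + t * c > 0"
        using tr a c det \<open>t > 0\<close> by (auto simp: \<delta>_def intro: add_pos_pos add_nonneg_pos)
      show "(tr + t * a) * (e + t * b) > \<delta> + t * c"
        using t1(2)[OF t] by (simp add: power2_eq_square algebra_simps)
    qed
  qed (rule t1)
qed

section \<open>Transfer from index functions to matrices\<close>

theorem proposition3p2:
  fixes n :: nat and H A :: "real mat" and v w :: "real vec"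
  assumes "n = 2 \<or> n = 3"
    and "H \<in> carrier_mat n n"
    and "0\<^sub>m n n \<le> H"
    and "irreducible_mat H"
    and "A = spectral_radius (complex_mat H) \<cdot>\<^sub>m 1\<^sub>m n - H"
    and "v \<in> carrier_vec n" and "0\<^sub>v n \<le> v" and "v \<noteq> 0\<^sub>v n"
    and "w \<in> carrier_vec n" and "0\<^sub>v n \<le> w" and "w \<noteq> 0\<^sub>v n"
    and "n = 3 \<Longrightarrow> w \<bullet> v \<noteq> 0"
  shows "\<exists>t1::real. t1 > 0 \<and>
    (\<forall>t>t1. \<forall>\<mu>::complex.
       eigenvalue (complex_mat (A + t \<cdot>\<^sub>m outer_prod v w)) \<mu> \<longrightarrow> Re \<mu> > 0)"
proof -
  note H = assms(2)
  have n: "n > 0" "n \<ge> 2" using assms(1) by auto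
  define \<rho> where "\<rho> = spectral_radius (complex_mat H)"
  define h where "h = (\<lambda>i j. H $$ (i, j))"
  define B where "B t = complex_mat (A + t \<cdot>\<^sub>m outer_prod v w)" for t
  have B: "B t \<in> carrier_mat n n" for t
    using assms(2,5,6,9) by (auto simp: B_def outer_prod_def)
  have B_nth: "B t $$ (i, j) = complex_of_real (shifted \<rho> h i j + t * (v $ i * w $ j))"
    if "i < n" "j < n" for t i j
    using that assms(2,5,6,9) by (auto simp: B_def outer_prod_def shifted_def \<rho>_def h_def)
  have h: "h i j \<ge> 0" if "i < n" "j < n" for i j
    using assms(2,3) that by (auto simp: less_eq_mat_def h_def)
  have v: "v $ i \<ge> 0" and w: "w $ i \<ge> 0" if "i < n" for i
    using assms(6,7,9,10) that by (auto simp: less_eq_vec_def)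
  have row: "\<exists>j<n. j \<noteq> i \<and> h i j \<noteq> 0" and col: "\<exists>j<n. j \<noteq> i \<and> h j i \<noteq> 0" if "i < n" for i
    using irreducible_row_nonzero[OF H assms(4) n(2) that]
      irreducible_col_nonzero[OF H assms(4) n(2) that] by (auto simp: h_def)
  \<comment> \<open>This fact and \<open>det\<close> are all the spectral information on
    \<open>H\<close> that the stability lemmas receive.\<close>
  have le: "poly (char_poly H) r \<le> 0 \<Longrightarrow> r \<le> \<rho>" for r
    unfolding \<rho>_def by (rule char_poly_le_0_imp_le_spectral_radius[OF H n(1)])
  have det: "poly (char_poly H) \<rho> \<ge> 0"
    unfolding \<rho>_def by (rule char_poly_spectral_radius_ge_0[OF H n(1)])
  have ev: "eigenvalue (B t) \<mu> \<longleftrightarrow> poly (char_poly (B t)) \<mu> = 0" for t \<mu>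
    by (rule eigenvalue_root_char_poly[OF B])
  show ?thesis
    unfolding B_def[symmetric] ev
  proof (cases "n = 2")
    case True
    obtain i0 j0 where i0: "i0 < 2" "v $ i0 \<noteq> 0" and j0: "j0 < 2" "w $ j0 \<noteq> 0"
      using assms(6,8,9,11) True by (metis carrier_vecD eq_vecI index_zero_vec)
    have char2B: "poly (char_poly (B t)) \<mu> =
        char2 (\<lambda>i j. complex_of_real (shifted \<rho> h i j + t * (v $ i * w $ j))) \<mu>" for t \<mu>
      using poly_char_poly_2[of "B t" \<mu>] B[of t] True by (simp add: char2_def B_nth)
    have char2H: "poly (char_poly H) x = char2 h x" for x
      using poly_char_poly_2[of H x] H True by (simp add: h_def)
    have off: "h 0 1 \<noteq> 0" "h 1 0 \<noteq> 0"
      using row[of 0] row[of 1] True by (auto simp: less_2_cases_iff)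
    show "\<exists>t1>0. \<forall>t>t1. \<forall>\<mu>. poly (char_poly (B t)) \<mu> = 0 \<longrightarrow> Re \<mu> > 0"
    \<comment> \<open>In dimension 2 every positive \<open>t\<close> works, so the threshold 1 is
      arbitrary.\<close>
    proof (intro exI[of _ 1] conjI allI impI)
      fix t :: real and \<mu>
      assume t: "t > 1" and root: "poly (char_poly (B t)) \<mu> = 0"
      show "Re \<mu> > 0"
        using root[unfolded char2B] h v w off le det i0 j0 True t unfolding char2H
        by (intro rank_one_stable_2[of h \<rho> "vec_index v" i0 "vec_index w" j0 t \<mu>]) auto
    qed simp
  next
    case False
    then have n3: "n = 3" using assms(1) by auto
    have char3B: "poly (char_poly (B t)) \<mu> =
        char3 (\<lambda>i j. complex_of_real (shifted \<rho> h i j + t * (v $ i * w $ j))) 0 1 2 \<mu>" for t \<mu>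
      using poly_char_poly_3[of "B t" \<mu>] B[of t] n3 by (simp add: char3_def B_nth)
    have char3H: "poly (char_poly H) x = char3 h 0 1 2 x" for x
      using poly_char_poly_3[of H x] H n3 by (simp add: h_def)
    have wv: "(\<Sum>i<3. w $ i * v $ i) \<noteq> 0"
      using assms(6,12) n3 by (auto simp: scalar_prod_def atLeast0LessThan)
    show "\<exists>t1>0. \<forall>t>t1. \<forall>\<mu>. poly (char_poly (B t)) \<mu> = 0 \<longrightarrow> Re \<mu> > 0"
      unfolding char3B
      using h row col le det v w wv unfolding n3 char3H by (intro rank_one_stable_3) auto
  qed
qed

end
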